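(* Every group representation of a (planar) ribbon is amenable.
   Context: Let $K$ be a planar CW space. A ribbon cycle is a simple closed curve formed by a finite sequence of path-connected vertices joined by edges, together with its (nonempty) interior. A planar ribbon $\mathrm{rb}\,E$ in $K$ is determined by a pair of nested filled cycles $\mathrm{cyc}\,A,\mathrm{cyc}\,B$ (with $\mathrm{cyc}\,B$ inside $\mathrm{cyc}\,A$) by excluding the interior of the inner cycle; the boundary of $\mathrm{cl}(\mathrm{cyc}\,B)$ is the inner boundary of $\mathrm{cl}(\mathrm{rb}\,E)$. The two cycles may have finitely many vertices in common, and finitely many bridge edges (edges attached between a vertex of one cycle and a vertex of the other) may be present. Group representation of a ribbon: the free finitely generated Abelian group whose generators are the vertices common to the two cycles of the ribbon together with the endpoints of the bridge edges attached between its cycles (written additively; $kg$ is read as $k$ moves along a path from the generator vertex $g$). Amenability: for a group (or semigroup) $\Sigma$, let $m(\Sigma)$ be the space of bounded real-valued functions $\theta$ on $\Sigma$ with norm $\|\theta\|=\sup_{x\in\Sigma}|\theta(x)|$. A mean on $m(\Sigma)$ is an element $\mu$ of the conjugate (dual) space $m(\Sigma)^*$ such that $\inf_{x\in\Sigma}\theta(x)\le\mu(\theta)\le\sup_{x\in\Sigma}\theta(x)$ for every $\theta\in m(\Sigma)$. It is left (right) invariant if $\mu(\ell_\sigma\theta)=\mu(\theta)$ (respectively $\mu(r_\sigma\theta)=\mu(\theta)$) for all $\theta\in m(\Sigma)$, $\sigma\in\Sigma$, where $(\ell_\sigma\theta)(x)=\theta(\sigma x)$ and $(r_\sigma\theta)(x)=\theta(x\sigma)$.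 $\Sigma$ is amenable if there is a mean on $m(\Sigma)$ that is both left and right invariant. *)

theory Defs
  imports "HOL-Analysis.Analysis" "HOL-Algebra.Free_Abelian_Groups"
begin

section \<open>Planar CW spaces\<close>

definition closed_disk :: "nat \<Rightarrow> (nat \<Rightarrow> real) topology" where
  "closed_disk n = subtopology (Euclidean_space n) {x. (\<Sum>i<n. x i ^ 2) \<le> 1}"

definition disk_interior :: "nat \<Rightarrow> (nat \<Rightarrow> real) set" where
  "disk_interior n = {x \<in> topspace (closed_disk n). (\<Sum>i<n. x i ^ 2) < 1}"

definition disk_boundary :: "nat \<Rightarrow> (nat \<Rightarrow> real) set" where
  "disk_boundary n = {x \<in> topspace (closed_disk n). (\<Sum>i<n. x i ^ 2) = 1}"

text \<open>A cell decomposition is a family \<open>C\<close>, where \<open>C n\<close> is the set of open \<open>n\<close>-cells.\<close>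

definition characteristic_map ::
  "'a topology \<Rightarrow> (nat \<Rightarrow> 'a set set) \<Rightarrow> nat \<Rightarrow> 'a set \<Rightarrow> ((nat \<Rightarrow> real) \<Rightarrow> 'a) \<Rightarrow> bool" where
  "characteristic_map X C n e \<Phi> \<longleftrightarrow>
     continuous_map (closed_disk n) X \<Phi> \<and>
     homeomorphic_map (subtopology (closed_disk n) (disk_interior n)) (subtopology X e) \<Phi> \<and>
     \<Phi> ` disk_boundary n \<subseteq> (\<Union>m<n. \<Union>(C m))"

definition cw_space :: "'a topology \<Rightarrow> (nat \<Rightarrow> 'a set set) \<Rightarrow> bool" where
  "cw_space X C \<longleftrightarrow>
     Hausdorff_space X \<and>
     topspace X = (\<Union>n. \<Union>(C n)) \<and>
     (\<forall>m n. \<forall>e\<in>C m. \<forall>f\<in>C n. (m, e) \<noteq> (n, f) \<longrightarrow> e \<inter> f = {}) \<and>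
     (\<forall>n. \<forall>e\<in>C n. \<exists>\<Phi>. characteristic_map X C n e \<Phi>) \<and>
     (\<forall>n. \<forall>e\<in>C n. finite {f. (\<exists>m. f \<in> C m) \<and> f \<inter> X closure_of e \<noteq> {}}) \<and>
     (\<forall>A. A \<subseteq> topspace X \<longrightarrow>
        (closedin X A \<longleftrightarrow>
          (\<forall>n. \<forall>e\<in>C n. closedin (subtopology X (X closure_of e)) (A \<inter> X closure_of e))))"

definition planar_cw_space :: "complex set \<Rightarrow> (nat \<Rightarrow> complex set set) \<Rightarrow> bool" where
  "planar_cw_space K C \<longleftrightarrow> cw_space (top_of_set K) C"

section \<open>Ribbons\<close>

text \<open>Edges are open 1-cells. Their endpoints are the points added by closing them up;
  an edge that is a loop has a single endpoint.\<close>

definition endpoints :: "complex set \<Rightarrow> complex set" where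
  "endpoints e = closure e - e"

record cell_cycle =
  verts :: "complex list"
  edges :: "complex set list"

definition curve :: "cell_cycle \<Rightarrow> complex set" where
  "curve A = set (verts A) \<union> \<Union>(set (edges A))"

definition filled_cycle :: "cell_cycle \<Rightarrow> complex set" where
  "filled_cycle A = curve A \<union> inside (curve A)"

definition ribbon_cycle :: "(nat \<Rightarrow> complex set set) \<Rightarrow> cell_cycle \<Rightarrow> bool" where
  "ribbon_cycle C A \<longleftrightarrow>
     verts A \<noteq> [] \<and> length (edges A) = length (verts A) \<and>
     distinct (verts A) \<and> distinct (edges A) \<and>
     (\<forall>i < length (verts A).
        {verts A ! i} \<in> C 0 \<and> edges A ! i \<in> C 1 \<and>
        endpoints (edges A ! i) = {verts A ! i, verts A ! (Suc i mod length (verts A))}) \<and>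
     (\<exists>g. simple_path g \<and> pathfinish g = pathstart g \<and> path_image g = curve A) \<and>
     inside (curve A) \<noteq> {}"

text \<open>A 1-cell lying on one of the two cycles is not a bridge, even if it starts
  at a common vertex.\<close>

definition bridge_edges ::
  "(nat \<Rightarrow> complex set set) \<Rightarrow> cell_cycle \<Rightarrow> cell_cycle \<Rightarrow> complex set set" where
  "bridge_edges C A B =
     {e \<in> C 1. e \<notin> set (edges A) \<union> set (edges B) \<and>
        (\<exists>u\<in>set (verts A). \<exists>v\<in>set (verts B). endpoints e = {u, v})}"

text \<open>\<open>S\<close> is the ribbon determined by the outer cycle \<open>A\<close> and the inner cycle \<open>B\<close>,
  with \<open>R\<close> its set of bridge edges. Only the open region enclosed by \<open>B\<close> is removed, so the
  curve of \<open>B\<close>, the inner boundary, belongs to \<open>S\<close>.\<close>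

definition planar_ribbon ::
  "(nat \<Rightarrow> complex set set) \<Rightarrow> cell_cycle \<Rightarrow> cell_cycle \<Rightarrow> complex set set \<Rightarrow> complex set \<Rightarrow> bool" where
  "planar_ribbon C A B R S \<longleftrightarrow>
     ribbon_cycle C A \<and> ribbon_cycle C B \<and>
     filled_cycle B \<subset> filled_cycle A \<and>
     finite R \<and> R \<subseteq> bridge_edges C A B \<and>
     S = filled_cycle A - inside (curve B)"

definition ribbon_generators ::
  "cell_cycle \<Rightarrow> cell_cycle \<Rightarrow> complex set set \<Rightarrow> complex set" where
  "ribbon_generators A B R = (set (verts A) \<inter> set (verts B)) \<union> (\<Union>e\<in>R. endpoints e)"

lemma finite_ribbon_generators:
  assumes "planar_ribbon C A B R S"
  shows "finite (ribbon_generators A B R)"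
proof -
  have "finite (endpoints e)" if "e \<in> R" for e
    using that assms unfolding planar_ribbon_def bridge_edges_def by force
  then show ?thesis
    using assms unfolding ribbon_generators_def planar_ribbon_def by blast
qed

definition group_representation ::
  "cell_cycle \<Rightarrow> cell_cycle \<Rightarrow> complex set set \<Rightarrow> (complex \<Rightarrow>\<^sub>0 int) monoid" where
  "group_representation A B R = free_Abelian_group (ribbon_generators A B R)"

section \<open>Amenability\<close>

text \<open>The elements of the function space \<open>m(G)\<close> are the bounded functions on the carrier,
  made unique by extensionality.\<close>

definition bounded_functions :: "('a, 'b) monoid_scheme \<Rightarrow> ('a \<Rightarrow> real) set" where
  "bounded_functions G = {\<theta> \<in> extensional (carrier G). bounded (\<theta> ` carrier G)}"

definition sup_norm :: "('a, 'b) monoid_scheme \<Rightarrow> ('a \<Rightarrow> real) \<Rightarrow> real" where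
  "sup_norm G \<theta> = (SUP x\<in>carrier G. \<bar>\<theta> x\<bar>)"

definition in_dual :: "('a, 'b) monoid_scheme \<Rightarrow> (('a \<Rightarrow> real) \<Rightarrow> real) \<Rightarrow> bool" where
  "in_dual G \<mu> \<longleftrightarrow>
     (\<forall>\<theta>\<in>bounded_functions G. \<forall>\<phi>\<in>bounded_functions G.
        \<mu> (\<lambda>x\<in>carrier G. \<theta> x + \<phi> x) = \<mu> \<theta> + \<mu> \<phi>) \<and>
     (\<forall>c. \<forall>\<theta>\<in>bounded_functions G. \<mu> (\<lambda>x\<in>carrier G. c * \<theta> x) = c * \<mu> \<theta>) \<and>
     (\<exists>M. \<forall>\<theta>\<in>bounded_functions G. \<bar>\<mu> \<theta>\<bar> \<le> M * sup_norm G \<theta>)"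

definition is_mean :: "('a, 'b) monoid_scheme \<Rightarrow> (('a \<Rightarrow> real) \<Rightarrow> real) \<Rightarrow> bool" where
  "is_mean G \<mu> \<longleftrightarrow> in_dual G \<mu> \<and>
     (\<forall>\<theta>\<in>bounded_functions G.
        (INF x\<in>carrier G. \<theta> x) \<le> \<mu> \<theta> \<and> \<mu> \<theta> \<le> (SUP x\<in>carrier G. \<theta> x))"

definition left_translate ::
  "('a, 'b) monoid_scheme \<Rightarrow> 'a \<Rightarrow> ('a \<Rightarrow> real) \<Rightarrow> 'a \<Rightarrow> real" where
  "left_translate G s \<theta> = (\<lambda>x\<in>carrier G. \<theta> (s \<otimes>\<^bsub>G\<^esub> x))"

definition right_translate ::
  "('a, 'b) monoid_scheme \<Rightarrow> 'a \<Rightarrow> ('a \<Rightarrow> real) \<Rightarrow> 'a \<Rightarrow> real" where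
  "right_translate G s \<theta> = (\<lambda>x\<in>carrier G. \<theta> (x \<otimes>\<^bsub>G\<^esub> s))"

definition left_invariant :: "('a, 'b) monoid_scheme \<Rightarrow> (('a \<Rightarrow> real) \<Rightarrow> real) \<Rightarrow> bool" where
  "left_invariant G \<mu> \<longleftrightarrow>
     (\<forall>\<theta>\<in>bounded_functions G. \<forall>s\<in>carrier G. \<mu> (left_translate G s \<theta>) = \<mu> \<theta>)"

definition right_invariant :: "('a, 'b) monoid_scheme \<Rightarrow> (('a \<Rightarrow> real) \<Rightarrow> real) \<Rightarrow> bool" where
  "right_invariant G \<mu> \<longleftrightarrow>
     (\<forall>\<theta>\<in>bounded_functions G. \<forall>s\<in>carrier G. \<mu> (right_translate G s \<theta>) = \<mu> \<theta>)"

definition amenable :: "('a, 'b) monoid_scheme \<Rightarrow> bool" where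
  "amenable G \<longleftrightarrow> (\<exists>\<mu>. is_mean G \<mu> \<and> left_invariant G \<mu> \<and> right_invariant G \<mu>)"

end

theory Submission
  imports Defs
begin

text \<open>Commutative monoids are amenable, and a free Abelian group is one. Starting from evaluation
  at the identity, composing a mean with the averaging operator over \<open>{s^k | k < N}\<close> makes it
  almost \<open>s\<close>-invariant, by telescoping; by commutativity, almost invariance under other elements
  is kept. So for every finite set \<open>F\<close> and every \<open>N\<close> there is a mean that is \<open>F\<close>-invariant up to
  \<open>O(1/N)\<close>. By Tychonoff, these means have a cluster point for pointwise convergence, and it is
  an exactly invariant mean.\<close>

section \<open>Bounded functions and means\<close>

lemma bounded_functions_iff:
  "\<theta> \<in> bounded_functions G \<longleftrightarrow> \<theta> \<in> extensional (carrier G) \<and> (\<exists>c. \<forall>x\<in>carrier G. \<bar>\<theta> x\<bar> \<le> c)"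
  by (auto simp: bounded_functions_def bounded_iff)

lemma restrict_bounded_function:
  assumes "\<And>x. x \<in> carrier G \<Longrightarrow> \<bar>f x\<bar> \<le> c"
  shows "(\<lambda>x\<in>carrier G. f x) \<in> bounded_functions G"
  using assms by (auto simp: bounded_functions_iff)

lemma abs_le_sup_norm:
  assumes "\<theta> \<in> bounded_functions G" "x \<in> carrier G"
  shows "\<bar>\<theta> x\<bar> \<le> sup_norm G \<theta>"
  unfolding sup_norm_def
  using assms by (intro cSUP_upper) (auto simp: bounded_functions_iff bdd_above_def)

lemma add_bounded_functions:
  assumes "\<theta> \<in> bounded_functions G" "\<phi> \<in> bounded_functions G"
  shows "(\<lambda>x\<in>carrier G. \<theta> x + \<phi> x) \<in> bounded_functions G"
  by (rule restrict_bounded_function[OF order_trans[OF abs_triangle_ineq]])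
    (rule add_mono[OF abs_le_sup_norm[OF assms(1)] abs_le_sup_norm[OF assms(2)]])

lemma scale_bounded_functions:
  assumes "\<theta> \<in> bounded_functions G"
  shows "(\<lambda>x\<in>carrier G. c * \<theta> x) \<in> bounded_functions G"
  using abs_le_sup_norm[OF assms]
  by (intro restrict_bounded_function[where c = "\<bar>c\<bar> * sup_norm G \<theta>"])
    (auto simp: abs_mult intro!: mult_left_mono)

lemma is_mean_le:
  assumes "is_mean G \<mu>" "\<theta> \<in> bounded_functions G" "carrier G \<noteq> {}"
    and "\<And>x. x \<in> carrier G \<Longrightarrow> \<theta> x \<le> c"
  shows "\<mu> \<theta> \<le> c"
proof -
  have "\<mu> \<theta> \<le> (SUP x\<in>carrier G. \<theta> x)"
    using assms by (simp add: is_mean_def)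
  also have "\<dots> \<le> c"
    using assms by (intro cSUP_least) auto
  finally show ?thesis .
qed

lemma is_mean_add:
  assumes "is_mean G \<mu>" "\<theta> \<in> bounded_functions G" "\<phi> \<in> bounded_functions G"
  shows "\<mu> (\<lambda>x\<in>carrier G. \<theta> x + \<phi> x) = \<mu> \<theta> + \<mu> \<phi>"
  using assms by (simp add: is_mean_def in_dual_def)

lemma is_mean_scale:
  assumes "is_mean G \<mu>" "\<theta> \<in> bounded_functions G"
  shows "\<mu> (\<lambda>x\<in>carrier G. c * \<theta> x) = c * \<mu> \<theta>"
  using assms by (simp add: is_mean_def in_dual_def)

text \<open>The upper bound applied to \<open>(-1) * \<theta>\<close> yields the lower bound by
  homogeneity, and the two bounds together yield continuity with constant 1 for the sup norm. So
  linearity and one inequality are all that has to be checked for each functional below.\<close>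

lemma is_meanI:
  assumes ne: "carrier G \<noteq> {}"
    and add: "\<And>\<theta> \<phi>. \<theta> \<in> bounded_functions G \<Longrightarrow> \<phi> \<in> bounded_functions G \<Longrightarrow>
      \<mu> (\<lambda>x\<in>carrier G. \<theta> x + \<phi> x) = \<mu> \<theta> + \<mu> \<phi>"
    and scale: "\<And>c \<theta>. \<theta> \<in> bounded_functions G \<Longrightarrow> \<mu> (\<lambda>x\<in>carrier G. c * \<theta> x) = c * \<mu> \<theta>"
    and le: "\<And>c \<theta>. \<theta> \<in> bounded_functions G \<Longrightarrow> (\<And>x. x \<in> carrier G \<Longrightarrow> \<theta> x \<le> c) \<Longrightarrow> \<mu> \<theta> \<le> c"
  shows "is_mean G \<mu>"
proof -
  have ge: "c \<le> \<mu> \<theta>" if "\<theta> \<in> bounded_functions G" "\<And>x. x \<in> carrier G \<Longrightarrow> c \<le> \<theta> x" for c \<theta>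
    using le[OF scale_bounded_functions[of \<theta> G "-1"], of "-c"] scale[of \<theta> "-1"] that by simp
  have "\<bar>\<mu> \<theta>\<bar> \<le> 1 * sup_norm G \<theta>" if "\<theta> \<in> bounded_functions G" for \<theta>
    using le[OF that, of "sup_norm G \<theta>"] ge[OF that, of "- sup_norm G \<theta>"] abs_le_sup_norm[OF that]
    by (simp add: abs_le_iff) (metis abs_le_iff minus_le_iff)
  moreover have "\<mu> \<theta> \<le> (SUP x\<in>carrier G. \<theta> x)" if "\<theta> \<in> bounded_functions G" for \<theta>
    using that abs_le_sup_norm[OF that]
    by (intro le[OF that] cSUP_upper) (auto simp: bdd_above_def abs_le_iff)
  moreover have "(INF x\<in>carrier G. \<theta> x) \<le> \<mu> \<theta>" if "\<theta> \<in> bounded_functions G" for \<theta>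
    using that abs_le_sup_norm[OF that]
    by (intro ge[OF that] cINF_lower bdd_belowI2[where m = "- sup_norm G \<theta>"])
      (auto simp: abs_le_iff minus_le_iff)
  ultimately show ?thesis
    using add scale unfolding is_mean_def in_dual_def by blast
qed

lemma is_mean_abs_le:
  assumes "is_mean G \<mu>" "\<theta> \<in> bounded_functions G" "carrier G \<noteq> {}"
    and "\<And>x. x \<in> carrier G \<Longrightarrow> \<bar>\<theta> x\<bar> \<le> c"
  shows "\<bar>\<mu> \<theta>\<bar> \<le> c"
proof -
  have "\<mu> \<theta> \<le> c"
    by (rule is_mean_le[OF assms(1-3)]) (use assms(4) in \<open>auto simp: abs_le_iff\<close>)
  moreover have "\<mu> (\<lambda>x\<in>carrier G. (-1) * \<theta> x) \<le> c"
    by (rule is_mean_le[OF assms(1) scale_bounded_functions[OF assms(2)] assms(3)])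
      (use assms(4) in \<open>auto simp: abs_le_iff\<close>)
  ultimately show ?thesis
    using is_mean_scale[OF assms(1,2), of "-1"] by (simp add: abs_le_iff)
qed

lemma is_mean_diff:
  assumes "is_mean G \<mu>" "\<theta> \<in> bounded_functions G" "\<phi> \<in> bounded_functions G"
  shows "\<mu> (\<lambda>x\<in>carrier G. \<theta> x - \<phi> x) = \<mu> \<theta> - \<mu> \<phi>"
proof -
  have "(\<lambda>x\<in>carrier G. \<theta> x - \<phi> x) = (\<lambda>x\<in>carrier G. \<theta> x + (\<lambda>x\<in>carrier G. (-1) * \<phi> x) x)"
    by (auto simp: restrict_def)
  then show ?thesis
    using is_mean_add[OF assms(1,2) scale_bounded_functions[OF assms(3), of "-1"]]
      is_mean_scale[OF assms(1,3), of "-1"] by simp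
qed

section \<open>Averaging over powers of an element\<close>

text \<open>This is the Cesaro average of the first \<open>N\<close> iterates of translation by
  \<open>s\<close>. Restriction to the carrier makes the result extensional, so that it is again an
  element of \<open>bounded_functions G\<close>.\<close>

definition power_average ::
  "('a, 'b) monoid_scheme \<Rightarrow> 'a \<Rightarrow> nat \<Rightarrow> ('a \<Rightarrow> real) \<Rightarrow> 'a \<Rightarrow> real" where
  "power_average G s N \<theta> =
     (\<lambda>x\<in>carrier G. (\<Sum>k<N. \<theta> (s [^]\<^bsub>G\<^esub> k \<otimes>\<^bsub>G\<^esub> x)) / real N)"

context comm_monoid
begin

lemma carrier_nonempty: "carrier G \<noteq> {}"
  using one_closed by blast

lemma left_translate_bounded_functions:
  assumes "\<theta> \<in> bounded_functions G" "s \<in> carrier G"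
  shows "left_translate G s \<theta> \<in> bounded_functions G"
  unfolding left_translate_def
  using assms
  by (intro restrict_bounded_function[where c = "sup_norm G \<theta>"] abs_le_sup_norm) auto

lemma power_average_le:
  assumes "s \<in> carrier G" "0 < N" "\<And>x. x \<in> carrier G \<Longrightarrow> \<theta> x \<le> c" "x \<in> carrier G"
  shows "power_average G s N \<theta> x \<le> c"
proof -
  have "(\<Sum>k<N. \<theta> (s [^] k \<otimes> x)) \<le> (\<Sum>k<N. c)"
    using assms by (intro sum_mono) auto
  then show ?thesis
    using assms by (simp add: power_average_def field_simps)
qed

lemma power_average_abs_le:
  assumes "s \<in> carrier G" "0 < N" "\<theta> \<in> bounded_functions G" "x \<in> carrier G"
  shows "\<bar>power_average G s N \<theta> x\<bar> \<le> sup_norm G \<theta>"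
proof -
  have "\<bar>\<Sum>k<N. \<theta> (s [^] k \<otimes> x)\<bar> \<le> (\<Sum>k<N. sup_norm G \<theta>)"
    using assms by (intro order_trans[OF sum_abs] sum_mono abs_le_sup_norm) auto
  then show ?thesis
    using assms by (simp add: power_average_def field_simps)
qed

lemma power_average_bounded_functions:
  assumes "s \<in> carrier G" "0 < N" "\<theta> \<in> bounded_functions G"
  shows "power_average G s N \<theta> \<in> bounded_functions G"
  using power_average_abs_le[OF assms]
  by (auto simp: bounded_functions_iff power_average_def)

text \<open>Because averaging is a contraction, error bounds obtained for other elements do not grow
  when one more average is composed.\<close>

lemma sup_norm_power_average_le:
  assumes "s \<in> carrier G" "0 < N" "\<theta> \<in> bounded_functions G"
  shows "sup_norm G (power_average G s N \<theta>) \<le> sup_norm G \<theta>"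
  unfolding sup_norm_def[of G "power_average G s N \<theta>"]
  using power_average_abs_le[OF assms] carrier_nonempty by (intro cSUP_least)

text \<open>Averaging is linear and preserves upper bounds. With \<open>N = 0\<close> the average
  would be the zero function, and the composition would not be a mean.\<close>

lemma is_mean_power_average:
  assumes "is_mean G \<mu>" "s \<in> carrier G" "0 < N"
  shows "is_mean G (\<lambda>\<theta>. \<mu> (power_average G s N \<theta>))"
proof (rule is_meanI[OF carrier_nonempty])
  fix \<theta> \<phi> assume *: "\<theta> \<in> bounded_functions G" "\<phi> \<in> bounded_functions G"
  have "power_average G s N (\<lambda>x\<in>carrier G. \<theta> x + \<phi> x) =
      (\<lambda>x\<in>carrier G. power_average G s N \<theta> x + power_average G s N \<phi> x)"
    using assms by (auto simp: power_average_def restrict_def sum.distrib add_divide_distrib)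
  then show "\<mu> (power_average G s N (\<lambda>x\<in>carrier G. \<theta> x + \<phi> x)) =
      \<mu> (power_average G s N \<theta>) + \<mu> (power_average G s N \<phi>)"
    using * assms by (simp add: is_mean_add power_average_bounded_functions)
next
  fix c \<theta> assume *: "\<theta> \<in> bounded_functions G"
  have "power_average G s N (\<lambda>x\<in>carrier G. c * \<theta> x) =
      (\<lambda>x\<in>carrier G. c * power_average G s N \<theta> x)"
    using assms by (auto simp: power_average_def restrict_def sum_distrib_left)
  then show "\<mu> (power_average G s N (\<lambda>x\<in>carrier G. c * \<theta> x)) = c * \<mu> (power_average G s N \<theta>)"
    using * assms by (simp add: is_mean_scale power_average_bounded_functions)
next
  fix c \<theta> assume "\<theta> \<in> bounded_functions G" "\<And>x. x \<in> carrier G \<Longrightarrow> \<theta> x \<le> c"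
  then show "\<mu> (power_average G s N \<theta>) \<le> c"
    using assms carrier_nonempty
    by (intro is_mean_le[OF assms(1) power_average_bounded_functions] power_average_le)
qed

text \<open>Commutativity enters here: \<open>s [^] k\<close> can be moved past
  \<open>t\<close>.\<close>

lemma power_average_left_translate:
  assumes "s \<in> carrier G" "t \<in> carrier G"
  shows "power_average G s N (left_translate G t \<theta>) = left_translate G t (power_average G s N \<theta>)"
  using assms by (auto simp: power_average_def left_translate_def restrict_def m_lcomm)

text \<open>Translating the average by \<open>s\<close> shifts the summation index by one, so only
  the two end terms of the difference survive. Each is at most \<open>sup_norm G \<theta>\<close> in
  absolute value.\<close>

lemma power_average_almost_invariant:
  assumes "is_mean G \<mu>" "s \<in> carrier G" "0 < N" "\<theta> \<in> bounded_functions G"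
  shows "\<bar>\<mu> (power_average G s N (left_translate G s \<theta>)) - \<mu> (power_average G s N \<theta>)\<bar>
    \<le> 2 * sup_norm G \<theta> / N"
proof -
  let ?d = "\<lambda>x\<in>carrier G. power_average G s N (left_translate G s \<theta>) x - power_average G s N \<theta> x"
  have d: "\<bar>?d x\<bar> \<le> 2 * sup_norm G \<theta> / N" if "x \<in> carrier G" for x
  proof -
    \<comment> \<open>\<open>nat_pow_Suc\<close> puts the new factor on the right, while translation
      puts it on the left. The form with \<open>Suc k\<close> is kept so that the sum
      telescopes.\<close>
    have "s \<otimes> (s [^] k \<otimes> x) = s [^] Suc k \<otimes> x" for k :: nat
      using assms(2) that by (metis m_assoc m_comm nat_pow_Suc nat_pow_closed)
    then have "?d x = (\<Sum>k<N. \<theta> (s [^] Suc k \<otimes> x) - \<theta> (s [^] k \<otimes> x)) / N"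
      using assms(2) that
      by (simp add: power_average_def left_translate_def diff_divide_distrib sum_subtractf
          del: nat_pow_Suc)
    also have "\<dots> = (\<theta> (s [^] N \<otimes> x) - \<theta> x) / N"
      using that sum_lessThan_telescope[of "\<lambda>k. \<theta> (s [^] k \<otimes> x)" N] by simp
    finally have "\<bar>?d x\<bar> = \<bar>\<theta> (s [^] N \<otimes> x) - \<theta> x\<bar> / N"
      by simp
    also have "\<dots> \<le> 2 * sup_norm G \<theta> / N"
      using abs_le_sup_norm[OF assms(4), of x] abs_le_sup_norm[OF assms(4), of "s [^] N \<otimes> x"]
        assms(2) that by (intro divide_right_mono) auto
    finally show ?thesis .
  qed
  have "\<bar>\<mu> ?d\<bar> \<le> 2 * sup_norm G \<theta> / N"
    by (rule is_mean_abs_le[OF assms(1) restrict_bounded_function carrier_nonempty])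
      (use d in auto)
  then show ?thesis
    using assms is_mean_diff[OF assms(1)]
    by (simp add: power_average_bounded_functions left_translate_bounded_functions)
qed

text \<open>Each induction step composes the mean with the average over powers of the new element.
  The bound depends on \<open>N\<close> and \<theta> but not on \<open>F\<close>, so it tends to 0
  however \<open>F\<close> grows.\<close>

lemma almost_invariant_mean_exists:
  assumes "finite F" "F \<subseteq> carrier G" "0 < N"
  shows "\<exists>\<mu>. is_mean G \<mu> \<and> (\<forall>s\<in>F. \<forall>\<theta>\<in>bounded_functions G.
    \<bar>\<mu> (left_translate G s \<theta>) - \<mu> \<theta>\<bar> \<le> 2 * sup_norm G \<theta> / real N)"
  using assms(1,2)
proof (induction F rule: finite_induct)
  case empty
  have "is_mean G (\<lambda>\<theta>. \<theta> \<one>)"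
    by (rule is_meanI[OF carrier_nonempty]) auto
  then show ?case by blast
next
  case (insert s F)
  then obtain \<mu> where \<mu>: "is_mean G \<mu>" and inv: "\<And>t \<theta>. t \<in> F \<Longrightarrow> \<theta> \<in> bounded_functions G \<Longrightarrow>
      \<bar>\<mu> (left_translate G t \<theta>) - \<mu> \<theta>\<bar> \<le> 2 * sup_norm G \<theta> / real N"
    by auto
  have s: "s \<in> carrier G" and F: "F \<subseteq> carrier G"
    using insert.prems by auto
  let ?\<nu> = "\<lambda>\<theta>. \<mu> (power_average G s N \<theta>)"
  have "\<bar>?\<nu> (left_translate G t \<theta>) - ?\<nu> \<theta>\<bar> \<le> 2 * sup_norm G \<theta> / real N"
    if t: "t \<in> insert s F" and \<theta>: "\<theta> \<in> bounded_functions G" for t \<theta>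
  proof (cases "t = s")
    case True
    then show ?thesis
      using power_average_almost_invariant[OF \<mu> s assms(3) \<theta>] by simp
  next
    case False
    then have "t \<in> F" using t by simp
    \<comment> \<open>Average and translation commute, so this is the induction hypothesis for the
      function \<open>power_average G s N \<theta>\<close>.\<close>
    then have "\<bar>?\<nu> (left_translate G t \<theta>) - ?\<nu> \<theta>\<bar> \<le> 2 * sup_norm G (power_average G s N \<theta>) / N"
      using inv[OF _ power_average_bounded_functions[OF s assms(3) \<theta>]] F s
      by (auto simp: power_average_left_translate subsetD)
    also have "\<dots> \<le> 2 * sup_norm G \<theta> / N"
      using sup_norm_power_average_le[OF s assms(3) \<theta>] by (simp add: divide_right_mono)
    finally show ?thesis .
  qed
  then show ?case
    using is_mean_power_average[OF \<mu> s assms(3)] by blast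
qed

end

section \<open>Cluster points of families of means\<close>

text \<open>Tychonoff's theorem, carried over from abstract topologies to the type class topology on
  functions, which is that of pointwise convergence.\<close>

lemma compact_Pi_UNIV:
  fixes B :: "'a \<Rightarrow> 'b::topological_space set"
  assumes "\<And>i. compact (B i)"
  shows "compact (Pi UNIV B)"
  using assms compactin_PiE[of "\<lambda>i. euclidean" UNIV B]
  by (simp add: euclidean_product_topology PiE_UNIV_domain)

text \<open>The conditions in \<open>is_meanI\<close> are equations and inequalities between values
  at single functions, hence survive pointwise limits. The finer filter \<open>H\<close> plays the
  role of a convergent subnet, and \<open>H \<le> F\<close> transfers to \<open>H\<close> whatever
  holds eventually along \<open>F\<close>.\<close>

lemma mean_cluster_point:
  fixes m :: "'i \<Rightarrow> ('a \<Rightarrow> real) \<Rightarrow> real"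
  assumes ne: "carrier G \<noteq> {}" and mean: "\<And>i. is_mean G (m i)" and F: "F \<noteq> bot"
  obtains \<mu> H where "H \<noteq> bot" "H \<le> F" "is_mean G \<mu>"
    "\<And>\<theta>. \<theta> \<in> bounded_functions G \<Longrightarrow> ((\<lambda>i. m i \<theta>) \<longlongrightarrow> \<mu> \<theta>) H"
proof -
  \<comment> \<open>The values of a mean at unbounded functions are irrelevant; setting them to 0 puts all means
    into a product of compact intervals.\<close>
  define m' where "m' i \<theta> = (if \<theta> \<in> bounded_functions G then m i \<theta> else 0)" for i \<theta>
  define U where
    "U = Pi UNIV (\<lambda>\<theta>. if \<theta> \<in> bounded_functions G then {- sup_norm G \<theta>..sup_norm G \<theta>} else {0})"
  have "compact U"
    unfolding U_def by (intro compact_Pi_UNIV) auto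
  moreover have "\<bar>m i \<theta>\<bar> \<le> sup_norm G \<theta>" if "\<theta> \<in> bounded_functions G" for i \<theta>
    by (rule is_mean_abs_le[OF mean that ne abs_le_sup_norm[OF that]])
  then have "m' i \<in> U" for i
    by (auto simp: U_def m'_def abs_le_iff minus_le_iff)
  ultimately obtain \<mu> where \<mu>: "inf (nhds \<mu>) (filtermap m' F) \<noteq> bot"
    using F unfolding compact_filter by (metis always_eventually eventually_filtermap filtermap_bot_iff)
  \<comment> \<open>The preimages of the neighbourhoods of \<mu> are added to \<open>F\<close>,
    which forces convergence of \<open>m'\<close> to \<mu>.\<close>
  define H where "H = inf F (filtercomap m' (nhds \<mu>))"
  have H: "H \<noteq> bot"
  proof
    assume "H = bot"
    then obtain P Q where P: "eventually P F" and Q: "eventually Q (nhds \<mu>)"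
      and PQ: "\<And>i. P i \<Longrightarrow> \<not> Q (m' i)"
      unfolding H_def trivial_limit_def eventually_inf eventually_filtercomap by blast
    \<comment> \<open>If \<open>H\<close> were trivial, \<open>m'\<close> would eventually avoid a
      neighbourhood of \<mu>, against the choice of \<mu> as a cluster point.\<close>
    have "eventually (\<lambda>f. \<not> Q f) (filtermap m' F)"
      using P PQ by (auto simp: eventually_filtermap elim: eventually_mono)
    then show False
      using \<mu> Q unfolding trivial_limit_def eventually_inf by blast
  qed
  have m'_lim: "filterlim m' (nhds \<mu>) H"
    unfolding H_def filterlim_def filtermap_le_iff_le_filtercomap by simp
  have lim': "((\<lambda>i. m' i \<theta>) \<longlongrightarrow> \<mu> \<theta>) H" for \<theta>
  proof -
    \<comment> \<open>Evaluation at a fixed function is a coordinate projection of the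
      product.\<close>
    have "continuous_on UNIV (\<lambda>f :: ('a \<Rightarrow> real) \<Rightarrow> real. f \<theta>)"
      by simp
    then have "((\<lambda>f. f \<theta>) \<longlongrightarrow> \<mu> \<theta>) (nhds \<mu>)"
      using tendsto_at_iff_tendsto_nhds[of "\<lambda>f. f \<theta>" \<mu>] by (simp add: continuous_on_def)
    then show ?thesis
      using m'_lim by (rule filterlim_compose)
  qed
  have lim: "((\<lambda>i. m i \<theta>) \<longlongrightarrow> \<mu> \<theta>) H" if "\<theta> \<in> bounded_functions G" for \<theta>
    using lim'[of \<theta>] that by (simp add: m'_def)
  have "is_mean G \<mu>"
  proof (rule is_meanI[OF ne])
    fix \<theta> \<phi> assume *: "\<theta> \<in> bounded_functions G" "\<phi> \<in> bounded_functions G"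
    show "\<mu> (\<lambda>x\<in>carrier G. \<theta> x + \<phi> x) = \<mu> \<theta> + \<mu> \<phi>"
      using lim[OF add_bounded_functions[OF *]] tendsto_add[OF lim[OF *(1)] lim[OF *(2)]]
      unfolding is_mean_add[OF mean *] by (rule tendsto_unique[OF H])
  next
    fix c \<theta> assume *: "\<theta> \<in> bounded_functions G"
    show "\<mu> (\<lambda>x\<in>carrier G. c * \<theta> x) = c * \<mu> \<theta>"
      using lim[OF scale_bounded_functions[OF *]] tendsto_mult_left[OF lim[OF *]]
      unfolding is_mean_scale[OF mean *] by (rule tendsto_unique[OF H])
  next
    fix c \<theta> assume *: "\<theta> \<in> bounded_functions G" "\<And>x. x \<in> carrier G \<Longrightarrow> \<theta> x \<le> c"
    show "\<mu> \<theta> \<le> c"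
      using is_mean_le[OF mean *(1) ne *(2)] by (intro tendsto_upperbound[OF lim[OF *(1)] _ H]) auto
  qed
  with H lim show ?thesis
    using that[of H \<mu>] by (simp add: H_def)
qed

section \<open>Exactly invariant means\<close>

text \<open>The almost invariant means are indexed by pairs of a finite set and a number. Along the
  product filter every fixed \<open>s\<close> eventually lies in the set while the error tends to 0,
  so a cluster point is left invariant; right invariance follows by commutativity.\<close>

theorem (in comm_monoid) amenable: "amenable G"
proof -
  \<comment> \<open>The implication makes the choice of means total: if \<open>fst p\<close> is not
    a finite subset of the carrier, any mean will do, here the one for \<open>{}\<close>.
    \<open>Suc (snd p)\<close> keeps the number of averaged terms positive.\<close>
  have "\<exists>\<mu>. is_mean G \<mu> \<and> (finite (fst p) \<and> fst p \<subseteq> carrier G \<longrightarrow>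
      (\<forall>s\<in>fst p. \<forall>\<theta>\<in>bounded_functions G.
        \<bar>\<mu> (left_translate G s \<theta>) - \<mu> \<theta>\<bar> \<le> 2 * sup_norm G \<theta> / real (Suc (snd p))))"
    for p :: "'a set \<times> nat"
    using almost_invariant_mean_exists[of "fst p" "Suc (snd p)"]
      almost_invariant_mean_exists[of "{}" 1]
    by (cases "finite (fst p) \<and> fst p \<subseteq> carrier G") auto
  then obtain m :: "'a set \<times> nat \<Rightarrow> ('a \<Rightarrow> real) \<Rightarrow> real" where mean: "\<And>p. is_mean G (m p)"
    and inv: "\<And>p s \<theta>. finite (fst p) \<Longrightarrow> fst p \<subseteq> carrier G \<Longrightarrow> s \<in> fst p \<Longrightarrow>
      \<theta> \<in> bounded_functions G \<Longrightarrow>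
      \<bar>m p (left_translate G s \<theta>) - m p \<theta>\<bar> \<le> 2 * sup_norm G \<theta> / real (Suc (snd p))"
    by metis
  let ?F = "finite_subsets_at_top (carrier G) \<times>\<^sub>F sequentially"
  have F: "?F \<noteq> bot"
    by (simp add: prod_filter_eq_bot)
  obtain \<mu> H where H: "H \<noteq> bot" "H \<le> ?F" and \<mu>: "is_mean G \<mu>"
    and lim: "\<And>\<theta>. \<theta> \<in> bounded_functions G \<Longrightarrow> ((\<lambda>p. m p \<theta>) \<longlongrightarrow> \<mu> \<theta>) H"
    by (rule mean_cluster_point[where m = m, OF carrier_nonempty mean F]) (rule that)
  have left: "\<mu> (left_translate G s \<theta>) = \<mu> \<theta>"
    if \<theta>: "\<theta> \<in> bounded_functions G" and s: "s \<in> carrier G" for \<theta> s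
  proof -
    have "eventually (\<lambda>X. finite X \<and> X \<subseteq> carrier G \<and> s \<in> X) (finite_subsets_at_top (carrier G))"
      unfolding eventually_finite_subsets_at_top using s by (intro exI[of _ "{s}"]) auto
    then have "eventually (\<lambda>p. finite (fst p) \<and> fst p \<subseteq> carrier G \<and> s \<in> fst p) H"
      using filterlim_mono[OF filterlim_fst order_refl H(2)] by (rule eventually_compose_filterlim)
    then have "eventually (\<lambda>p. \<bar>m p (left_translate G s \<theta>) - m p \<theta>\<bar>
        \<le> 2 * sup_norm G \<theta> / real (Suc (snd p))) H"
      by (rule eventually_mono) (use inv \<theta> in blast)
    moreover have "((\<lambda>p. \<bar>m p (left_translate G s \<theta>) - m p \<theta>\<bar>)
        \<longlongrightarrow> \<bar>\<mu> (left_translate G s \<theta>) - \<mu> \<theta>\<bar>) H"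
      by (intro tendsto_intros lim left_translate_bounded_functions \<theta> s)
    moreover have "((\<lambda>p. 2 * sup_norm G \<theta> / real (Suc (snd p))) \<longlongrightarrow> 0) H"
    proof -
      have "(\<lambda>n. 2 * sup_norm G \<theta> / real (Suc n)) \<longlonglongrightarrow> 0"
        unfolding divide_inverse by (intro tendsto_mult_right_zero LIMSEQ_inverse_real_of_nat)
      then show ?thesis
        using filterlim_mono[OF filterlim_snd order_refl H(2)] by (rule filterlim_compose)
    qed
    \<comment> \<open>The inequality holds eventually along \<open>H\<close>, and both of its sides
      converge there.\<close>
    ultimately have "\<bar>\<mu> (left_translate G s \<theta>) - \<mu> \<theta>\<bar> \<le> 0"
      using tendsto_le[OF H(1)] by blast
    then show ?thesis by simp
  qed
  moreover have "right_translate G s \<theta> = left_translate G s \<theta>" if "s \<in> carrier G" for s \<theta>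
    using that by (auto simp: right_translate_def left_translate_def restrict_def m_comm)
  ultimately show ?thesis
    using \<mu> unfolding amenable_def left_invariant_def right_invariant_def by auto
qed

theorem theorem10:
  fixes K S :: "complex set" and C :: "nat \<Rightarrow> complex set set"
    and A B :: cell_cycle and R :: "complex set set"
  assumes "planar_cw_space K C"
    and "planar_ribbon C A B R S"
  shows "amenable (group_representation A B R)"
proof -
  \<comment> \<open>A commutative group is in particular a commutative monoid, so the fact
    \<open>amenable\<close> becomes available for this group.\<close>
  interpret comm_group "free_Abelian_group (ribbon_generators A B R)"
    by (rule abelian_free_Abelian_group)
  show ?thesis
    unfolding group_representation_def by (rule amenable)
qed

end
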